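(* Let $M_1$ and $M_2$ be $q$-matroids on trivially intersecting ground spaces $E_1$ and $E_2$, respectively, over the same field, and let $E=E_1\oplus E_2$. Let $\perp$ be an involutive anti-isomorphism of $\mathcal{L}(E)$ such that $E_1^\perp=E_2$. Then $$(M_1\oplus M_2)^*=M_1^*\oplus M_2^*,$$ where the dual $(M_1\oplus M_2)^*$ is taken with respect to $\perp$ and, for $i=1,2$, the dual $M_i^*$ is taken with respect to the anti-isomorphism $\perp\!(E_i)$ of $\mathcal{L}(E_i)$ given by $A^{\perp(E_i)}=A^\perp\cap E_i$.
   Context: A $q$-matroid is a pair $(E,r)$, where $E$ is a finite-dimensional vector space over a field and $r$ is an integer-valued function on the lattice $\mathcal{L}(E)$ of subspaces of $E$ such that: (R1) $0\le r(A)\le\dim A$ for all $A$; (R2) $A\subseteq B$ implies $r(A)\le r(B)$; (R3) $r(A+B)+r(A\cap B)\le r(A)+r(B)$ for all $A,B$. The notation $r(M;A)$ is the rank of $A$ in the $q$-matroid $M$. An anti-isomorphism of $\mathcal{L}(E)$ is an order-reversing bijection $\mathcal{L}(E)\to\mathcal{L}(E)$ interchanging sum and intersection. Given an anti-isomorphism $\perp$ of $\mathcal{L}(E)$ that is an involution, the dual of $M=(E,r)$ with respect to $\perp$ is the $q$-matroid $M^*=(E,r^* )$ with $r^*(A)=\dim A-r(E)+r(A^\perp)$. Matroid union: for $q$-matroids $N_1,N_2$ on the same ground space $E$, the matroid union $N_1\vee N_2$ is the $q$-matroid on $E$ with rank function $r(A)=\min_{X\subseteq A}\{r(N_1;X)+r(N_2;X)+\dim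 A-\dim X\}$. Direct sum: let $E=E_1\oplus E_2$. Let $M_1'$ be the $q$-matroid on $E$ obtained from $M_1$ by adding $\dim E_2$ loops, namely with rank function $r(M_1';A)=r(M_1;(A+E_2)\cap E_1)$; let $M_2'$ be the $q$-matroid on $E$ obtained from $M_2$ by adding $\dim E_1$ loops, namely with rank function $r(M_2';A)=r(M_2;(A+E_1)\cap E_2)$. The direct sum is $M_1\oplus M_2:=M_1'\vee M_2'$. *)

theory Defs
  imports Complex_Main "HOL-Library.FuncSet" "HOL-Library.Set_Algebras"
begin

text \<open>
  All spaces are finite-dimensional subspaces of one ambient vector space \<open>'v\<close> over a field \<open>'k\<close>
  with scalar multiplication \<open>scale\<close>, which itself may be infinite-dimensional.
  Sums of subspaces are the elementwise sums of \<^theory>\<open>HOL-Library.Set_Algebras\<close>.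
\<close>

definition finite_dim :: "('k::field \<Rightarrow> 'v::ab_group_add \<Rightarrow> 'v) \<Rightarrow> 'v set \<Rightarrow> bool" where
  "finite_dim scale E \<longleftrightarrow>
     module.subspace scale E \<and> (\<exists>B. finite B \<and> module.span scale B = E)"

definition subspaces :: "('k::field \<Rightarrow> 'v::ab_group_add \<Rightarrow> 'v) \<Rightarrow> 'v set \<Rightarrow> 'v set set" where
  "subspaces scale E = {A. module.subspace scale A \<and> A \<subseteq> E}"

type_synonym 'v qmat = "'v set \<times> ('v set \<Rightarrow> int)"

abbreviation ground :: "'v qmat \<Rightarrow> 'v set" where
  "ground M \<equiv> fst M"

abbreviation rank :: "'v qmat \<Rightarrow> 'v set \<Rightarrow> int" where
  "rank M \<equiv> snd M"

text \<open>
  The rank is a function on the subspaces of the ground space only. Requiring it to be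
  \<^const>\<open>extensional\<close> there makes equality of pairs coincide with equality of q-matroids.
\<close>

definition q_matroid :: "('k::field \<Rightarrow> 'v::ab_group_add \<Rightarrow> 'v) \<Rightarrow> 'v qmat \<Rightarrow> bool" where
  "q_matroid scale M \<longleftrightarrow>
     finite_dim scale (ground M) \<and>
     rank M \<in> extensional (subspaces scale (ground M)) \<and>
     (\<forall>A\<in>subspaces scale (ground M).
        0 \<le> rank M A \<and> rank M A \<le> int (vector_space.dim scale A)) \<and>
     (\<forall>A\<in>subspaces scale (ground M). \<forall>B\<in>subspaces scale (ground M).
        A \<subseteq> B \<longrightarrow> rank M A \<le> rank M B) \<and>
     (\<forall>A\<in>subspaces scale (ground M). \<forall>B\<in>subspaces scale (ground M).
        rank M (A + B) + rank M (A \<inter> B) \<le> rank M A + rank M B)"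

definition anti_isomorphism ::
    "('k::field \<Rightarrow> 'v::ab_group_add \<Rightarrow> 'v) \<Rightarrow> 'v set \<Rightarrow> ('v set \<Rightarrow> 'v set) \<Rightarrow> bool" where
  "anti_isomorphism scale E perp \<longleftrightarrow>
     bij_betw perp (subspaces scale E) (subspaces scale E) \<and>
     (\<forall>A\<in>subspaces scale E. \<forall>B\<in>subspaces scale E.
        (A \<subseteq> B \<longrightarrow> perp B \<subseteq> perp A) \<and>
        perp (A + B) = perp A \<inter> perp B \<and>
        perp (A \<inter> B) = perp A + perp B)"

definition involutive_anti_isomorphism ::
    "('k::field \<Rightarrow> 'v::ab_group_add \<Rightarrow> 'v) \<Rightarrow> 'v set \<Rightarrow> ('v set \<Rightarrow> 'v set) \<Rightarrow> bool" where
  "involutive_anti_isomorphism scale E perp \<longleftrightarrow>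
     anti_isomorphism scale E perp \<and> (\<forall>A\<in>subspaces scale E. perp (perp A) = A)"

lemma (in vector_space) subspace_set_plus:
  assumes "subspace A" "subspace B"
  shows "subspace (A + B)"
proof -
  have "A + B = {x + y |x y. x \<in> A \<and> y \<in> B}"
    by (auto simp: set_plus_def)
  then show ?thesis
    using subspace_sums[OF assms] by simp
qed

lemma (in vector_space) subspaces_sum:
  assumes "A \<in> subspaces scale E" "B \<in> subspaces scale E" "subspace E"
  shows "A + B \<in> subspaces scale E"
  using assms subspace_set_plus
  by (auto simp: subspaces_def elim!: set_plus_elim intro!: subspace_add[of E])

text \<open>The restriction of \<open>perp\<close> used for the duals of the summands is of the required kind.\<close>

lemma involutive_anti_isomorphism_restrict:
  assumes "vector_space scale"
    and "module.subspace scale F" "module.subspace scale G" "F \<inter> G = {0}"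
    and P: "involutive_anti_isomorphism scale (F + G) perp" and FG: "perp F = G"
  shows "involutive_anti_isomorphism scale F (\<lambda>A. perp A \<inter> F)"
proof -
  interpret vector_space scale by fact
  note sub = assms(2,3)
  let ?E = "F + G" and ?p = "\<lambda>A. perp A \<inter> F"
  have 0: "0 \<in> F" "0 \<in> G" using sub by (auto simp: subspace_0)
  have FE: "F \<subseteq> ?E" and GE: "G \<subseteq> ?E"
    using 0 by (force simp: set_plus_def)+
  have F: "F \<in> subspaces scale ?E" and G: "G \<in> subspaces scale ?E"
    using sub FE GE by (auto simp: subspaces_def)
  have up: "A \<in> subspaces scale ?E" if "A \<in> subspaces scale F" for A
    using that FE by (auto simp: subspaces_def)
  have pin: "perp A \<in> subspaces scale ?E" if "A \<in> subspaces scale ?E" for A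
    using P that by (auto simp: involutive_anti_isomorphism_def anti_isomorphism_def bij_betw_def)
  have anti: "perp B \<subseteq> perp A"
    if "A \<in> subspaces scale ?E" "B \<in> subspaces scale ?E" "A \<subseteq> B" for A B
    using P that by (auto simp: involutive_anti_isomorphism_def anti_isomorphism_def)
  have psum: "perp (A + B) = perp A \<inter> perp B" and pint: "perp (A \<inter> B) = perp A + perp B"
    if "A \<in> subspaces scale ?E" "B \<in> subspaces scale ?E" for A B
    using P that by (auto simp: involutive_anti_isomorphism_def anti_isomorphism_def)
  have pp: "perp (perp A) = A" if "A \<in> subspaces scale ?E" for A
    using P that by (auto simp: involutive_anti_isomorphism_def)
  have GF: "perp G = F" using pp[OF F] FG by simp
  have p_in: "?p A \<in> subspaces scale F" if "A \<in> subspaces scale F" for A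
    using pin[OF up[OF that]] sub by (auto simp: subspaces_def intro: subspace_inter)
  have modular: "(A + G) \<inter> F = A" if "A \<in> subspaces scale F" for A
  proof
    show "(A + G) \<inter> F \<subseteq> A"
    proof
      fix x assume "x \<in> (A + G) \<inter> F"
      then obtain a g where x: "x = a + g" "a \<in> A" "g \<in> G" "x \<in> F"
        by (auto elim: set_plus_elim)
      have "a \<in> F" using x(2) that by (auto simp: subspaces_def)
      then have "x - a \<in> F" using x(4) sub(1) by (intro subspace_diff)
      then have "g \<in> F \<inter> G" using x(1,3) by simp
      then show "x \<in> A" using x(1,2) assms(4) by simp
    qed
    show "A \<subseteq> (A + G) \<inter> F"
      using that 0 by (force simp: subspaces_def set_plus_def)
  qed
  have p_inv: "?p (?p A) = A" if "A \<in> subspaces scale F" for A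
    using pint[OF pin[OF up[OF that]] F] pp[OF up[OF that]] FG modular[OF that] by simp
  have p_sum: "?p (A + B) = ?p A \<inter> ?p B"
    if "A \<in> subspaces scale F" "B \<in> subspaces scale F" for A B
    using psum[OF up up] that by auto
  have p_int: "?p (A \<inter> B) = ?p A + ?p B"
    if A: "A \<in> subspaces scale F" and B: "B \<in> subspaces scale F" for A B
  proof -
    have "?p (?p A + ?p B) = A \<inter> B"
      by (simp only: p_sum[OF p_in[OF A] p_in[OF B]] p_inv[OF A] p_inv[OF B])
    then show ?thesis
      using p_inv[OF subspaces_sum[OF p_in[OF A] p_in[OF B] sub(1)]] by (simp only:)
  qed
  have "bij_betw ?p (subspaces scale F) (subspaces scale F)"
    by (rule bij_betw_byWitness[where f' = ?p]) (use p_inv p_in in auto)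
  moreover have "?p B \<subseteq> ?p A"
    if "A \<in> subspaces scale F" "B \<in> subspaces scale F" "A \<subseteq> B" for A B
    using anti[OF up up] that by blast
  ultimately show ?thesis
    unfolding involutive_anti_isomorphism_def anti_isomorphism_def
    by (intro conjI ballI impI p_sum p_int p_inv)
qed

definition q_dual ::
    "('k::field \<Rightarrow> 'v::ab_group_add \<Rightarrow> 'v) \<Rightarrow> ('v set \<Rightarrow> 'v set) \<Rightarrow> 'v qmat \<Rightarrow> 'v qmat" where
  "q_dual scale perp M =
     (ground M,
      \<lambda>A\<in>subspaces scale (ground M).
        int (vector_space.dim scale A) - rank M (ground M) + rank M (perp A))"

text \<open>
  Meant for \<open>N1\<close> and \<open>N2\<close> on the same ground space. There may be infinitely many \<open>X\<close>, but the
  set of values is finite (lemma \<open>finite_union_values\<close>), so \<^const>\<open>Min\<close> is the minimum.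
\<close>

definition q_union ::
    "('k::field \<Rightarrow> 'v::ab_group_add \<Rightarrow> 'v) \<Rightarrow> 'v qmat \<Rightarrow> 'v qmat \<Rightarrow> 'v qmat" where
  "q_union scale N1 N2 =
     (ground N1,
      \<lambda>A\<in>subspaces scale (ground N1).
        Min ((\<lambda>X. rank N1 X + rank N2 X
                    + int (vector_space.dim scale A) - int (vector_space.dim scale X))
             ` subspaces scale A))"

lemma finite_union_values:
  assumes V: "vector_space scale"
    and N1: "q_matroid scale N1" and N2: "q_matroid scale N2" and g: "ground N2 = ground N1"
    and A: "A \<in> subspaces scale (ground N1)"
  shows "finite ((\<lambda>X. rank N1 X + rank N2 X
                    + int (vector_space.dim scale A) - int (vector_space.dim scale X))
             ` subspaces scale A)"
proof -
  interpret vector_space scale by (rule V)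
  obtain B where B: "finite B" "span B = ground N1"
    using N1 by (auto simp: q_matroid_def finite_dim_def)
  have d: "dim X \<le> card B" if "X \<in> subspaces scale (ground N1)" for X
    using that B by (intro dim_le_card) (auto simp: subspaces_def)
  have "rank N1 X + rank N2 X + int (dim A) - int (dim X)
          \<in> {- int (card B)..3 * int (card B)}" if "X \<in> subspaces scale A" for X
  proof -
    have X: "X \<in> subspaces scale (ground N1)"
      using that A by (auto simp: subspaces_def)
    have "0 \<le> rank N1 X" "rank N1 X \<le> int (dim X)" "0 \<le> rank N2 X" "rank N2 X \<le> int (dim X)"
      using N1 N2 X g by (auto simp: q_matroid_def)
    then show ?thesis using d[OF X] d[OF A] by auto
  qed
  then show ?thesis
    by (intro finite_subset[OF _ finite_atLeastAtMost_int]) blast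
qed

text \<open>\<open>add_loops scale M F\<close> extends \<open>M\<close> by \<open>dim F\<close> loops, for \<open>F\<close> meeting the ground space trivially.\<close>

definition add_loops ::
    "('k::field \<Rightarrow> 'v::ab_group_add \<Rightarrow> 'v) \<Rightarrow> 'v qmat \<Rightarrow> 'v set \<Rightarrow> 'v qmat" where
  "add_loops scale M F =
     (ground M + F, \<lambda>A\<in>subspaces scale (ground M + F). rank M ((A + F) \<inter> ground M))"

definition q_direct_sum ::
    "('k::field \<Rightarrow> 'v::ab_group_add \<Rightarrow> 'v) \<Rightarrow> 'v qmat \<Rightarrow> 'v qmat \<Rightarrow> 'v qmat" where
  "q_direct_sum scale M1 M2 =
     q_union scale (add_loops scale M1 (ground M2)) (add_loops scale M2 (ground M1))"

end

theory Submission
  imports Defs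
begin

text \<open>
  Write \<open>p\<^sub>i X\<close> for the projection of \<open>X\<close> to \<open>E\<^sub>i\<close>, that is \<open>(X + E\<^sub>2) \<inter> E\<^sub>1\<close> for \<open>i = 1\<close>.
  By definition the rank of \<open>A\<close> in a direct sum is the minimum over subspaces \<open>X\<close> of \<open>A\<close> of
  \<open>r\<^sub>1 (p\<^sub>1 X) + r\<^sub>2 (p\<^sub>2 X) + dim A - dim X\<close>. The point is that it is also a minimum over the
  subspaces \<open>Y\<close> of \<open>E\<close> that contain \<open>A\<close>, now with the intersections of \<open>Y\<close> with the two summands
  instead of projections, namely of
  \<open>r\<^sub>1 (Y \<inter> E\<^sub>1) + r\<^sub>2 (Y \<inter> E\<^sub>2) + dim Y - dim (Y \<inter> E\<^sub>1) - dim (Y \<inter> E\<^sub>2)\<close>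
  (lemmas \<open>rank_q_direct_sum_le_superspace\<close> and \<open>rank_q_direct_sum_superspace\<close>). One passes from
  \<open>X\<close> to \<open>Y = A + (p\<^sub>1 X + p\<^sub>2 X)\<close>, and from \<open>Y\<close> to \<open>X = A \<inter> (Y \<inter> E\<^sub>1 + Y \<inter> E\<^sub>2)\<close>. The value does not
  increase either way, because each \<open>r\<^sub>i\<close> is monotone and grows by at most the increase in dimension.

  Duality exchanges the two descriptions. An involutive anti-isomorphism maps the subspaces of
  \<open>A\<^sup>\<perp>\<close> to the superspaces of \<open>A\<close>, turns \<open>dim\<close> into \<open>dim E - dim\<close>, and, as \<open>E\<^sub>1\<close> and \<open>E\<^sub>2\<close> are each
  other's images, turns the projection to \<open>E\<^sub>i\<close> into the intersection with \<open>E\<^sub>i\<close>: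
  \<open>(Y\<^sup>\<perp> + E\<^sub>2) \<inter> E\<^sub>1 = (Y \<inter> E\<^sub>1)\<^sup>\<perp> \<inter> E\<^sub>1\<close>. The first description, for \<open>M\<^sub>1 \<oplus> M\<^sub>2\<close> at \<open>A\<^sup>\<perp>\<close>, thus becomes
  the second one for \<open>M\<^sub>1\<^sup>* \<oplus> M\<^sub>2\<^sup>*\<close> at \<open>A\<close>.

  The anti-isomorphism is only given on the lattice of subspaces, so what it does to dimensions has
  to be read off from the order. Lemma \<open>dim_diff_le_strict_mono\<close> does this, and also yields the
  modular law for \<open>dim\<close>.
\<close>

section \<open>Dimension as height in the lattice of subspaces\<close>

context vector_space
begin

lemma basis_extension:
  assumes "finite_dim scale B" "A \<in> subspaces scale B"
  obtains C D where "finite C" "finite D" "independent (C \<union> D)" "C \<inter> D = {}"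
    "span C = A" "span (C \<union> D) = B"
proof -
  have sA: "subspace A" "A \<subseteq> B" and sB: "subspace B"
    using assms by (auto simp: subspaces_def finite_dim_def)
  obtain T where T: "finite T" "span T = B"
    using assms by (auto simp: finite_dim_def)
  obtain C where C: "C \<subseteq> A" "independent C" "A \<subseteq> span C"
    using maximal_independent_subset by blast
  obtain C' where C': "C \<subseteq> C'" "C' \<subseteq> B" "independent C'" "B \<subseteq> span C'"
    using maximal_independent_subset_extend[of C B] C sA by blast
  have "finite C'"
    using independent_span_bound[OF T(1) C'(3)] C'(2) T(2) by simp
  moreover have "C \<union> (C' - C) = C'"
    using C' by blast
  moreover have "span C = A" "span C' = B"
    using span_subspace[OF C(1,3) sA(1)] span_subspace[OF C'(2,4) sB] by blast+
  ultimately show thesis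
    using that[of C "C' - C"] C' finite_subset[of C C'] by (simp add: Diff_disjoint)
qed

lemma finite_dim_subspaces:
  assumes "finite_dim scale B" "A \<in> subspaces scale B"
  shows "finite_dim scale A"
  using basis_extension[OF assms] assms(2)
  by (metis (no_types, lifting) finite_dim_def mem_Collect_eq subspaces_def)

lemma dim_subspace:
  assumes "finite_dim scale B" "A \<in> subspaces scale B"
  shows dim_mono_finite: "dim A \<le> dim B" and dim_strict_finite: "A \<noteq> B \<Longrightarrow> dim A < dim B"
proof -
  obtain C D where CD: "finite C" "finite D" "independent (C \<union> D)" "C \<inter> D = {}"
    "span C = A" "span (C \<union> D) = B"
    using basis_extension[OF assms] by metis
  have "independent C"
    using independent_mono[OF CD(3)] by blast
  then have "dim A = card C" "dim B = card C + card D"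
    using CD dim_span_eq_card_independent card_Un_disjoint by metis+
  moreover have "card D > 0" if "A \<noteq> B"
    using that CD by (auto simp: card_gt_0_iff)
  ultimately show "dim A \<le> dim B" "A \<noteq> B \<Longrightarrow> dim A < dim B"
    by auto
qed

lemma subspace_complement:
  assumes "finite_dim scale B" "A \<in> subspaces scale B"
  obtains C where "C \<in> subspaces scale B" "A + C = B" "dim A + dim C \<le> dim B"
proof -
  obtain C D where CD: "finite C" "finite D" "independent (C \<union> D)" "C \<inter> D = {}"
    "span C = A" "span (C \<union> D) = B"
    using basis_extension[OF assms] by metis
  have ind: "independent C" "independent D"
    using independent_mono[OF CD(3)] by blast+
  then have "dim A = card C" "dim (span D) = card D" "dim B = card C + card D"
    using CD dim_span_eq_card_independent card_Un_disjoint by metis+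
  moreover have "span D \<in> subspaces scale B"
    using CD(6) span_mono[of D "C \<union> D"] by (auto simp: subspaces_def)
  moreover have "A + span D = B"
    using CD(5,6) span_Un[of C D] by (auto simp: set_plus_def)
  ultimately show thesis
    using that by simp
qed

lemma sum_upper:
  assumes "subspace A" "subspace B"
  shows "A \<subseteq> A + B" "B \<subseteq> A + B"
  using assms by (force simp: set_plus_def dest: subspace_0)+

lemma sum_least:
  assumes "subspace C" "A \<subseteq> C" "B \<subseteq> C"
  shows "A + B \<subseteq> C"
  using assms by (auto elim!: set_plus_elim intro!: subspace_add)

lemma finite_dim_sum:
  assumes "finite_dim scale A" "finite_dim scale B"
  shows "finite_dim scale (A + B)"
proof -
  obtain S T where "finite S" "span S = A" "finite T" "span T = B"
    using assms by (auto simp: finite_dim_def)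
  then have "span (S \<union> T) = A + B" "finite (S \<union> T)"
    using span_Un[of S T] by (auto simp: set_plus_def)
  then show ?thesis
    using subspace_span[of "S \<union> T"] unfolding finite_dim_def by metis
qed

text \<open>
  A maximal chain from \<open>A\<close> to \<open>B\<close> has \<open>dim B - dim A\<close> steps, and \<open>g\<close> gains at least one in each.
\<close>

lemma dim_diff_le_strict_mono:
  fixes g :: "'b set \<Rightarrow> int"
  assumes B: "finite_dim scale B" and A: "A \<in> subspaces scale B"
    and g: "\<And>X Y. \<lbrakk>X \<in> subspaces scale B; Y \<in> subspaces scale B; A \<subseteq> X; X \<subset> Y\<rbrakk> \<Longrightarrow> g X < g Y"
  shows "int (dim B) - int (dim A) \<le> g B - g A"
  using A g
proof (induction "dim B - dim A" arbitrary: A rule: less_induct)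
  case less
  show ?case
  proof (cases "A = B")
    case False
    have A: "A \<subseteq> B" "subspace A" and sB: "subspace B"
      using less.prems(1) B by (auto simp: subspaces_def finite_dim_def)
    obtain x where x: "x \<in> B" "x \<notin> A"
      using False A by blast
    define A' where "A' = span (insert x A)"
    have A': "A' \<in> subspaces scale B" "A \<subset> A'"
      using x A span_minimal[OF _ sB, of "insert x A"] span_superset[of "insert x A"]
      unfolding A'_def subspaces_def by auto
    have fA: "finite_dim scale A'" and AA': "A \<in> subspaces scale A'"
      using finite_dim_subspaces[OF B A'(1)] A A'(2) by (auto simp: subspaces_def)
    have lt: "dim A < dim A'"
      using dim_strict_finite[OF fA AA'] A'(2) by blast
    have "dim A' \<le> dim A + 1"
    proof -
      obtain C D where C: "finite C" "independent (C \<union> D)" "span C = A"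
        using basis_extension[OF B less.prems(1)] by metis
      have "dim A = card C"
        using dim_span_eq_card_independent[OF independent_mono[OF C(2), of C]] C(3) by auto
      moreover have "A' \<subseteq> span (insert x C)"
        unfolding A'_def using C(3) span_mono[of C "insert x C"] span_superset[of "insert x C"]
        by (intro span_minimal) auto
      then have "dim A' \<le> card (insert x C)"
        using C(1) by (intro dim_le_card) auto
      ultimately show ?thesis
        using card_insert_le_m1[of "card C + 1" C x] by simp
    qed
    moreover have "dim A < dim B"
      using dim_strict_finite[OF B less.prems(1) False] .
    then have "int (dim B) - int (dim A') \<le> g B - g A'"
      using lt A' by (intro less.hyps less.prems(2)) auto
    moreover have "g A < g A'"
      using less.prems A' by blast
    ultimately show ?thesis
      by linarith
  qed simp
qed

text \<open>
  Each of the maps \<open>X \<mapsto> X + B\<close> and \<open>X \<mapsto> X \<inter> A\<close> between the intervals \<open>[A \<inter> B, A]\<close> and \<open>[B, A + B]\<close>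
  is strictly monotone, since the lattice of subspaces is modular.
\<close>

lemma dim_sum_inter:
  assumes A: "finite_dim scale A" and B: "finite_dim scale B"
  shows "dim (A + B) + dim (A \<inter> B) = dim A + dim B"
proof -
  have s: "subspace A" "subspace B" "subspace (A + B)"
    using A B subspace_set_plus by (auto simp: finite_dim_def)
  note AB = finite_dim_sum[OF A B]
  have "int (dim A) - int (dim (A \<inter> B)) \<le> int (dim (A + B)) - int (dim ((A \<inter> B) + B))"
  proof (rule dim_diff_le_strict_mono[OF A])
    show "A \<inter> B \<in> subspaces scale A"
      using s by (auto simp: subspaces_def intro: subspace_inter)
  next
    fix X Y
    assume X: "X \<in> subspaces scale A" and Y: "Y \<in> subspaces scale A"
      and XY: "A \<inter> B \<subseteq> X" "X \<subset> Y"
    have sX: "subspace X" "X \<subseteq> A" and sY: "subspace Y" "Y \<subseteq> A"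
      using X Y by (auto simp: subspaces_def)
    have "finite_dim scale (Y + B)"
      using finite_dim_sum[OF finite_dim_subspaces[OF A Y] B] .
    moreover have "X + B \<subseteq> Y + B"
      using XY by (intro set_plus_mono2) auto
    then have "X + B \<in> subspaces scale (Y + B)"
      using sX s by (auto simp: subspaces_def subspace_set_plus)
    moreover have "X + B \<noteq> Y + B"
    proof
      assume eq: "X + B = Y + B"
      have "Y \<subseteq> X"
      proof
        fix y assume y: "y \<in> Y"
        then have "y \<in> X + B"
          using sum_upper[OF sY(1) s(2)] eq by auto
        then obtain x b where xb: "y = x + b" "x \<in> X" "b \<in> B"
          by (auto elim: set_plus_elim)
        then have "y - x \<in> A"
          using y sX sY s(1) by (intro subspace_diff) auto
        then have "b \<in> X"
          using xb XY(1) by auto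
        then show "y \<in> X"
          using xb sX by (auto intro: subspace_add)
      qed
      then show False
        using XY by blast
    qed
    ultimately show "int (dim (X + B)) < int (dim (Y + B))"
      using dim_strict_finite by auto
  qed
  moreover have "(A \<inter> B) + B = B"
    using s sum_least[of B "A \<inter> B" B] sum_upper(2)[of "A \<inter> B" B] subspace_inter[of A B] by auto
  moreover have "int (dim (A + B)) - int (dim B) \<le> int (dim ((A + B) \<inter> A)) - int (dim (B \<inter> A))"
  proof (rule dim_diff_le_strict_mono[OF AB])
    show "B \<in> subspaces scale (A + B)"
      using s sum_upper by (auto simp: subspaces_def)
  next
    fix X Y
    assume X: "X \<in> subspaces scale (A + B)" and Y: "Y \<in> subspaces scale (A + B)"
      and XY: "B \<subseteq> X" "X \<subset> Y"
    have sX: "subspace X" and sY: "subspace Y" "Y \<subseteq> A + B"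
      using X Y by (auto simp: subspaces_def)
    have "Y \<inter> A \<in> subspaces scale A" "X \<inter> A \<in> subspaces scale (Y \<inter> A)"
      using sX sY s XY by (auto simp: subspaces_def intro: subspace_inter)
    moreover from this have "finite_dim scale (Y \<inter> A)"
      using finite_dim_subspaces[OF A] by blast
    moreover have "X \<inter> A \<noteq> Y \<inter> A"
    proof
      assume eq: "X \<inter> A = Y \<inter> A"
      have "Y \<subseteq> X"
      proof
        fix y assume y: "y \<in> Y"
        then obtain a b where ab: "y = a + b" "a \<in> A" "b \<in> B"
          using sY by (blast elim: set_plus_elim)
        then have "y - b \<in> Y"
          using y sY XY by (intro subspace_diff) auto
        then have "a \<in> X"
          using ab eq by auto
        then show "y \<in> X"
          using ab sX XY by (auto intro: subspace_add)
      qed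
      then show False
        using XY by blast
    qed
    ultimately show "int (dim (X \<inter> A)) < int (dim (Y \<inter> A))"
      using dim_strict_finite by auto
  qed
  moreover have "(A + B) \<inter> A = A"
    using sum_upper[OF s(1,2)] by auto
  ultimately show ?thesis
    by (simp add: Int_commute)
qed

lemma dim_sum_le:
  assumes "finite_dim scale A" "finite_dim scale B"
  shows "dim (A + B) \<le> dim A + dim B"
  using dim_sum_inter[OF assms] by linarith

lemma dim_zero_space: "dim {0} = 0"
  using dim_le_card[of "{0}" "{}"] by simp

lemma dim_direct_sum:
  assumes "finite_dim scale A" "finite_dim scale B" "A \<inter> B = {0}"
  shows "dim (A + B) = dim A + dim B"
  using dim_sum_inter[OF assms(1,2)] assms(3) dim_zero_space by simp

section \<open>Anti-isomorphisms and duals\<close>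

lemma involutive_anti_isomorphismD:
  assumes "involutive_anti_isomorphism scale E perp"
  shows "\<And>A. A \<in> subspaces scale E \<Longrightarrow> perp A \<in> subspaces scale E"
    and "\<And>A. A \<in> subspaces scale E \<Longrightarrow> perp (perp A) = A"
    and "\<And>A B. \<lbrakk>A \<in> subspaces scale E; B \<in> subspaces scale E; A \<subseteq> B\<rbrakk> \<Longrightarrow> perp B \<subseteq> perp A"
    and "\<And>A B. \<lbrakk>A \<in> subspaces scale E; B \<in> subspaces scale E\<rbrakk> \<Longrightarrow> perp (A + B) = perp A \<inter> perp B"
    and "\<And>A B. \<lbrakk>A \<in> subspaces scale E; B \<in> subspaces scale E\<rbrakk> \<Longrightarrow> perp (A \<inter> B) = perp A + perp B"
  using assms by (auto simp: involutive_anti_isomorphism_def anti_isomorphism_def bij_betw_def)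

text \<open>
  As \<open>perp\<close> is strictly antitone, \<open>dim (perp A) - dim (perp B)\<close> is at least \<open>dim B - dim A\<close> for
  \<open>A \<subseteq> B\<close>. Applied to \<open>A \<subseteq> E\<close> and to \<open>0 \<subseteq> A\<close> this bounds \<open>dim (perp A)\<close> from below and from above.
\<close>

lemma dim_perp:
  assumes E: "finite_dim scale E" and P: "involutive_anti_isomorphism scale E perp"
    and A: "A \<in> subspaces scale E"
  shows "int (dim (perp A)) = int (dim E) - int (dim A)"
proof -
  note p = involutive_anti_isomorphismD[OF P]
  have sE: "subspace E"
    using E by (simp add: finite_dim_def)
  have gain: "int (dim B) - int (dim A) \<le> int (dim (perp A)) - int (dim (perp B))"
    if A: "A \<in> subspaces scale E" and B: "B \<in> subspaces scale E" and "A \<subseteq> B" for A B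
  proof -
    have "int (dim B) - int (dim A) \<le> - int (dim (perp B)) - (- int (dim (perp A)))"
    proof (rule dim_diff_le_strict_mono[where g = "\<lambda>X. - int (dim (perp X))"])
      show "finite_dim scale B"
        using finite_dim_subspaces[OF E B] .
      show "A \<in> subspaces scale B"
        using that by (auto simp: subspaces_def)
    next
      fix X Y
      assume "X \<in> subspaces scale B" "Y \<in> subspaces scale B" and XY: "A \<subseteq> X" "X \<subset> Y"
      then have X: "X \<in> subspaces scale E" and Y: "Y \<in> subspaces scale E"
        using B by (auto simp: subspaces_def)
      have "perp Y \<in> subspaces scale (perp X)"
        using p(1)[OF Y] p(3)[OF X Y] XY by (auto simp: subspaces_def)
      moreover have "perp Y \<noteq> perp X"
        using p(2)[OF X] p(2)[OF Y] XY by auto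
      ultimately show "- int (dim (perp X)) < - int (dim (perp Y))"
        using dim_strict_finite[OF finite_dim_subspaces[OF E p(1)[OF X]]] by auto
    qed
    then show ?thesis
      by simp
  qed
  have EE: "E \<in> subspaces scale E" and ZE: "{0} \<in> subspaces scale E"
    using sE subspace_0 by (auto simp: subspaces_def)
  have "perp E \<subseteq> perp (perp {0})"
    using p(1)[OF ZE] p(3)[OF p(1)[OF ZE] EE] by (auto simp: subspaces_def)
  then have "dim (perp E) = 0"
    using p(2)[OF ZE] dim_le_card[of "perp E" "{}"] by simp
  moreover have "{0} \<subseteq> A" "A \<subseteq> E"
    using A subspace_0 by (auto simp: subspaces_def)
  moreover have "dim (perp {0}) \<le> dim E"
    using dim_mono_finite[OF E p(1)[OF ZE]] .
  ultimately show ?thesis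
    using gain[OF ZE A] gain[OF A EE] dim_zero_space by simp
qed

lemma q_matroidD:
  assumes "q_matroid scale M"
  shows "finite_dim scale (ground M)" "ground M \<in> subspaces scale (ground M)"
    and "\<And>A. A \<in> subspaces scale (ground M) \<Longrightarrow> 0 \<le> rank M A"
    and "\<And>A. A \<in> subspaces scale (ground M) \<Longrightarrow> rank M A \<le> int (dim A)"
    and "\<And>A B. \<lbrakk>A \<in> subspaces scale (ground M); B \<in> subspaces scale (ground M); A \<subseteq> B\<rbrakk>
      \<Longrightarrow> rank M A \<le> rank M B"
    and "\<And>A B. \<lbrakk>A \<in> subspaces scale (ground M); B \<in> subspaces scale (ground M)\<rbrakk>
      \<Longrightarrow> rank M (A + B) + rank M (A \<inter> B) \<le> rank M A + rank M B"
  using assms by (auto simp: q_matroid_def finite_dim_def subspaces_def)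

text \<open>
  Submodularity, applied to \<open>A\<close> and a complement \<open>C\<close> of it in \<open>B\<close>, bounds the gain by the rank of
  \<open>C\<close>, hence by its dimension.
\<close>

lemma rank_diff_le_dim_diff:
  assumes M: "q_matroid scale M"
    and A: "A \<in> subspaces scale (ground M)" and B: "B \<in> subspaces scale (ground M)" and "A \<subseteq> B"
  shows "rank M B - rank M A \<le> int (dim B) - int (dim A)"
proof -
  note m = q_matroidD[OF M]
  have "finite_dim scale B" "A \<in> subspaces scale B"
    using finite_dim_subspaces[OF m(1) B] A \<open>A \<subseteq> B\<close> by (auto simp: subspaces_def)
  then obtain C where C: "C \<in> subspaces scale B" "A + C = B" "dim A + dim C \<le> dim B"
    by (rule subspace_complement)
  have CE: "C \<in> subspaces scale (ground M)" "A \<inter> C \<in> subspaces scale (ground M)"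
    using C A B by (auto simp: subspaces_def intro: subspace_inter)
  show ?thesis
    using m(6)[OF A CE(1)] m(3)[OF CE(2)] m(4)[OF CE(1)] C(2,3) by simp
qed

text \<open>
  Duality interchanges the two bounds on the growth of the rank: monotonicity of the dual rank is
  the bound by dimension for the original one, and conversely.
\<close>

lemma q_matroid_q_dual:
  assumes M: "q_matroid scale M" and P: "involutive_anti_isomorphism scale (ground M) perp"
  shows "q_matroid scale (q_dual scale perp M)"
proof -
  let ?E = "ground M"
  let ?r = "\<lambda>A. int (dim A) - rank M ?E + rank M (perp A)"
  note m = q_matroidD[OF M] and p = involutive_anti_isomorphismD[OF P]
  note dp = dim_perp[OF m(1) P]
  have sE: "subspace ?E"
    using m(2) by (auto simp: subspaces_def)
  have "0 \<le> ?r A \<and> ?r A \<le> int (dim A)" if A: "A \<in> subspaces scale ?E" for A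
  proof -
    have "perp A \<subseteq> ?E"
      using p(1)[OF A] by (auto simp: subspaces_def)
    then show ?thesis
      using rank_diff_le_dim_diff[OF M p(1)[OF A] m(2)] m(5)[OF p(1)[OF A] m(2)] dp[OF A] by simp
  qed
  moreover have "?r A \<le> ?r B"
    if A: "A \<in> subspaces scale ?E" and B: "B \<in> subspaces scale ?E" and "A \<subseteq> B" for A B
    using rank_diff_le_dim_diff[OF M p(1)[OF B] p(1)[OF A] p(3)[OF that]] dp[OF A] dp[OF B] by simp
  moreover have "?r (A + B) + ?r (A \<inter> B) \<le> ?r A + ?r B"
    if A: "A \<in> subspaces scale ?E" and B: "B \<in> subspaces scale ?E" for A B
    using m(6)[OF p(1)[OF A] p(1)[OF B]] p(4,5)[OF A B]
      dim_sum_inter[OF finite_dim_subspaces[OF m(1) A] finite_dim_subspaces[OF m(1) B]] by simp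
  moreover have "A + B \<in> subspaces scale ?E" "A \<inter> B \<in> subspaces scale ?E"
    if A: "A \<in> subspaces scale ?E" and B: "B \<in> subspaces scale ?E" for A B
    using that subspaces_sum[OF A B sE] by (auto simp: subspaces_def intro: subspace_inter)
  ultimately show ?thesis
    using m(1) by (simp add: q_matroid_def q_dual_def)
qed

section \<open>The rank of a direct sum\<close>

lemma direct_sum_projections:
  assumes F: "finite_dim scale F" and G: "finite_dim scale G"
    and X: "X \<in> subspaces scale (F + G)"
  shows "(X + G) \<inter> F \<in> subspaces scale F" "(X + F) \<inter> G \<in> subspaces scale G"
    and "X \<subseteq> (X + G) \<inter> F + (X + F) \<inter> G"
    and "dim X \<le> dim ((X + G) \<inter> F) + dim ((X + F) \<inter> G)"
proof -
  have s: "subspace F" "subspace G" "subspace X" "X \<subseteq> F + G"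
    using F G X by (auto simp: finite_dim_def subspaces_def)
  show p: "(X + G) \<inter> F \<in> subspaces scale F" "(X + F) \<inter> G \<in> subspaces scale G"
    using s by (auto simp: subspaces_def intro!: subspace_inter subspace_set_plus)
  show sub: "X \<subseteq> (X + G) \<inter> F + (X + F) \<inter> G"
  proof
    fix x assume x: "x \<in> X"
    then obtain f g where fg: "x = f + g" "f \<in> F" "g \<in> G"
      using s(4) by (blast elim: set_plus_elim)
    have "x + (- g) \<in> X + G" "x + (- f) \<in> X + F"
      using x fg(2,3) s(1,2) by (blast intro: set_plus_intro subspace_neg)+
    then have "f \<in> X + G" "g \<in> X + F"
      by (simp_all add: fg(1))
    then show "x \<in> (X + G) \<inter> F + (X + F) \<inter> G"
      using set_plus_intro[of f _ g] fg by simp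
  qed
  note fp = finite_dim_subspaces[OF F p(1)] finite_dim_subspaces[OF G p(2)]
  have "X \<in> subspaces scale ((X + G) \<inter> F + (X + F) \<inter> G)"
    using sub s by (auto simp: subspaces_def)
  then show "dim X \<le> dim ((X + G) \<inter> F) + dim ((X + F) \<inter> G)"
    using dim_mono_finite[OF finite_dim_sum[OF fp]] dim_sum_le[OF fp] by fastforce
qed

lemma rank_q_direct_sum:
  assumes M: "q_matroid scale M" and N: "q_matroid scale N"
    and A: "A \<in> subspaces scale (ground M + ground N)"
  defines "v \<equiv> \<lambda>X. rank M ((X + ground N) \<inter> ground M) + rank N ((X + ground M) \<inter> ground N)
    + int (dim A) - int (dim X)"
  shows rank_q_direct_sum_le: "\<And>X. X \<in> subspaces scale A \<Longrightarrow> rank (q_direct_sum scale M N) A \<le> v X"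
    and rank_q_direct_sum_attained: "\<exists>X\<in>subspaces scale A. rank (q_direct_sum scale M N) A = v X"
proof -
  note m = q_matroidD[OF M] and n = q_matroidD[OF N]
  note fE = finite_dim_sum[OF m(1) n(1)]
  have up: "X \<in> subspaces scale (ground M + ground N)" if "X \<in> subspaces scale A" for X
    using that A by (auto simp: subspaces_def)
  have eq: "rank (q_direct_sum scale M N) A = Min (v ` subspaces scale A)"
  proof -
    have "(\<lambda>X. rank (add_loops scale M (ground N)) X + rank (add_loops scale N (ground M)) X
        + int (dim A) - int (dim X)) ` subspaces scale A = v ` subspaces scale A"
      using up by (intro image_cong) (auto simp: add_loops_def v_def add.commute[of "ground N"])
    then show ?thesis
      using A by (simp add: q_direct_sum_def q_union_def add_loops_def)
  qed
  have fin: "finite (v ` subspaces scale A)"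
  proof (rule finite_subset[OF _ finite_atLeastAtMost_int])
    show "v ` subspaces scale A \<subseteq> {0..int (dim (ground M)) + int (dim (ground N)) + int (dim A)}"
    proof (rule image_subsetI)
      fix X assume X: "X \<in> subspaces scale A"
      note d = direct_sum_projections[OF m(1) n(1) up[OF X]]
      have "dim X \<le> dim A"
        using dim_mono_finite[OF finite_dim_subspaces[OF fE A] X] .
      moreover have "rank M ((X + ground N) \<inter> ground M) \<le> int (dim (ground M))"
        using m(4)[OF d(1)] dim_mono_finite[OF m(1) d(1)] by simp
      moreover have "rank N ((X + ground M) \<inter> ground N) \<le> int (dim (ground N))"
        using n(4)[OF d(2)] dim_mono_finite[OF n(1) d(2)] by simp
      ultimately show "v X \<in> {0..int (dim (ground M)) + int (dim (ground N)) + int (dim A)}"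
        using m(3)[OF d(1)] n(3)[OF d(2)] by (simp add: v_def)
    qed
  qed
  show "rank (q_direct_sum scale M N) A \<le> v X" if "X \<in> subspaces scale A" for X
    using fin that by (simp add: eq)
  have "subspaces scale A \<noteq> {}"
    using A by (auto simp: subspaces_def)
  then show "\<exists>X\<in>subspaces scale A. rank (q_direct_sum scale M N) A = v X"
    using Min_in[OF fin] by (auto simp: eq)
qed

text \<open>
  The choice \<open>X = ground M + ground N\<close> gives the upper bound. For any other \<open>X\<close>, the ranks of its
  projections fall short by at most the dimensions they miss, and \<open>dim X\<close> is at most the sum of
  the dimensions of the projections.
\<close>

lemma rank_q_direct_sum_ground:
  assumes M: "q_matroid scale M" and N: "q_matroid scale N" and MN: "ground M \<inter> ground N = {0}"
  shows "rank (q_direct_sum scale M N) (ground M + ground N)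
    = rank M (ground M) + rank N (ground N)"
proof (rule antisym)
  let ?E = "ground M + ground N"
  note m = q_matroidD[OF M] and n = q_matroidD[OF N]
  have s: "subspace (ground M)" "subspace (ground N)"
    using m(2) n(2) by (auto simp: subspaces_def)
  have E: "?E \<in> subspaces scale ?E"
    using s by (auto simp: subspaces_def subspace_set_plus)
  note sE = subspace_set_plus[OF s] and u = sum_upper[OF s]
  have "(?E + ground N) \<inter> ground M = ground M" "(?E + ground M) \<inter> ground N = ground N"
    using u sum_upper(1)[OF sE s(1)] sum_upper(1)[OF sE s(2)] by blast+
  then show "rank (q_direct_sum scale M N) ?E \<le> rank M (ground M) + rank N (ground N)"
    using rank_q_direct_sum_le[OF M N E E] by simp
next
  let ?E = "ground M + ground N"
  note m = q_matroidD[OF M] and n = q_matroidD[OF N]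
  have E: "?E \<in> subspaces scale ?E"
    using m(2) n(2) by (auto simp: subspaces_def subspace_set_plus)
  obtain X where X: "X \<in> subspaces scale ?E" "rank (q_direct_sum scale M N) ?E
      = rank M ((X + ground N) \<inter> ground M) + rank N ((X + ground M) \<inter> ground N)
        + int (dim ?E) - int (dim X)"
    using rank_q_direct_sum_attained[OF M N E] by blast
  note d = direct_sum_projections[OF m(1) n(1) X(1)]
  have "rank M (ground M) - rank M ((X + ground N) \<inter> ground M)
      \<le> int (dim (ground M)) - int (dim ((X + ground N) \<inter> ground M))"
    by (rule rank_diff_le_dim_diff[OF M d(1) m(2)]) simp
  moreover have "rank N (ground N) - rank N ((X + ground M) \<inter> ground N)
      \<le> int (dim (ground N)) - int (dim ((X + ground M) \<inter> ground N))"
    by (rule rank_diff_le_dim_diff[OF N d(2) n(2)]) simp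
  ultimately show "rank M (ground M) + rank N (ground N) \<le> rank (q_direct_sum scale M N) ?E"
    using X(2) d(4) dim_direct_sum[OF m(1) n(1) MN] by linarith
qed

text \<open>
  Put \<open>Z = Y \<inter> ground M + Y \<inter> ground N\<close>. The projections of \<open>X = A \<inter> Z\<close> lie in the two terms of
  \<open>Z\<close>, and \<open>dim A - dim X = dim (A + Z) - dim Z\<close> is at most \<open>dim Y - dim Z\<close>, as \<open>Y\<close> contains \<open>A + Z\<close>.
\<close>

lemma rank_q_direct_sum_le_superspace:
  assumes M: "q_matroid scale M" and N: "q_matroid scale N" and MN: "ground M \<inter> ground N = {0}"
    and A: "A \<in> subspaces scale (ground M + ground N)"
    and Y: "Y \<in> subspaces scale (ground M + ground N)" and AY: "A \<subseteq> Y"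
  shows "rank (q_direct_sum scale M N) A \<le> rank M (Y \<inter> ground M) + rank N (Y \<inter> ground N)
    + int (dim Y) - int (dim (Y \<inter> ground M)) - int (dim (Y \<inter> ground N))"
proof -
  let ?F = "ground M" and ?G = "ground N"
  note m = q_matroidD[OF M] and n = q_matroidD[OF N]
  note fE = finite_dim_sum[OF m(1) n(1)]
  have s: "subspace ?F" "subspace ?G" "subspace A" "subspace Y" "A \<subseteq> ?F + ?G"
    using m(2) n(2) A Y by (auto simp: subspaces_def)
  have YF: "Y \<inter> ?F \<in> subspaces scale ?F" and YG: "Y \<inter> ?G \<in> subspaces scale ?G"
    using s by (auto simp: subspaces_def intro: subspace_inter)
  define Z where "Z = Y \<inter> ?F + Y \<inter> ?G"
  define X where "X = A \<inter> Z"
  have sZ: "subspace Z"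
    unfolding Z_def using YF YG by (auto simp: subspaces_def subspace_set_plus)
  have X: "X \<in> subspaces scale A" "X \<subseteq> ?F + ?G"
    using s sZ by (auto simp: X_def subspaces_def intro: subspace_inter)
  note fYF = finite_dim_subspaces[OF m(1) YF] and fYG = finite_dim_subspaces[OF n(1) YG]
  have fZ: "finite_dim scale Z"
    unfolding Z_def by (rule finite_dim_sum[OF fYF fYG])
  have "(Y \<inter> ?F) \<inter> (Y \<inter> ?G) = {0}"
    using MN s by (auto dest: subspace_0)
  then have dZ: "dim Z = dim (Y \<inter> ?F) + dim (Y \<inter> ?G)"
    unfolding Z_def by (rule dim_direct_sum[OF fYF fYG])
  have "A + Z \<in> subspaces scale Y"
    using s sZ AY sum_least[OF s(4), of "Y \<inter> ?F" "Y \<inter> ?G"] sum_least[OF s(4) AY, of Z]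
    by (auto simp: subspaces_def subspace_set_plus Z_def)
  then have "dim (A + Z) \<le> dim Y"
    using dim_mono_finite[OF finite_dim_subspaces[OF fE Y]] by blast
  then have 1: "int (dim A) - int (dim X) \<le> int (dim Y) - int (dim Z)"
    using dim_sum_inter[OF finite_dim_subspaces[OF fE A] fZ] unfolding X_def by linarith
  have *: "f \<in> Y \<inter> F'"
    if F': "subspace F'" "subspace G'" "F' \<inter> G' = {0}"
      and f: "f \<in> (Y \<inter> F' + Y \<inter> G') + G'" "f \<in> F'"
    for f F' G'
  proof -
    obtain a b c where abc: "f = (a + b) + c" "a \<in> Y \<inter> F'" "b \<in> Y \<inter> G'" "c \<in> G'"
      using f(1) by (blast elim: set_plus_elim)
    have "f - a = b + c"
      using abc(1) by simp
    moreover have "f - a \<in> F'" "b + c \<in> G'"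
      using abc F' f(2) subspace_diff[of F' f a] subspace_add[of G' b c] by blast+
    ultimately have "f - a = 0"
      using F'(3) by auto
    then show ?thesis
      using abc(2) by simp
  qed
  have "X + ?G \<subseteq> (Y \<inter> ?F + Y \<inter> ?G) + ?G" "X + ?F \<subseteq> (Y \<inter> ?G + Y \<inter> ?F) + ?F"
    unfolding X_def Z_def add.commute[of "Y \<inter> ?G"] by (intro set_plus_mono2 order_refl Int_lower2)+
  then have "(X + ?G) \<inter> ?F \<subseteq> Y \<inter> ?F" "(X + ?F) \<inter> ?G \<subseteq> Y \<inter> ?G"
    using *[OF s(1,2) MN] *[OF s(2,1)] MN by (simp_all add: Int_commute subset_iff)
  moreover have "X \<in> subspaces scale (?F + ?G)"
    using X by (auto simp: subspaces_def)
  note d = direct_sum_projections[OF m(1) n(1) this]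
  ultimately have "rank M ((X + ?G) \<inter> ?F) \<le> rank M (Y \<inter> ?F)"
    "rank N ((X + ?F) \<inter> ?G) \<le> rank N (Y \<inter> ?G)"
    using m(5)[OF d(1) YF] n(5)[OF d(2) YG] by auto
  then show ?thesis
    using rank_q_direct_sum_le[OF M N A X(1)] 1 dZ by linarith
qed

text \<open>
  For \<open>X\<close> attaining the minimum that defines the rank, let \<open>Z\<close> be the sum of the projections of \<open>X\<close>
  and \<open>Y = A + Z\<close>. Since \<open>X \<subseteq> A \<inter> Z\<close>, \<open>dim Y - dim Z\<close> is at most \<open>dim A - dim X\<close>. The intersections
  of \<open>Y\<close> with the two ground spaces may exceed the projections of \<open>X\<close>, but rank minus dimension
  does not increase.
\<close>

lemma rank_q_direct_sum_superspace:
  assumes M: "q_matroid scale M" and N: "q_matroid scale N" and MN: "ground M \<inter> ground N = {0}"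
    and A: "A \<in> subspaces scale (ground M + ground N)"
  obtains Y where "Y \<in> subspaces scale (ground M + ground N)" "A \<subseteq> Y"
    "rank M (Y \<inter> ground M) + rank N (Y \<inter> ground N)
      + int (dim Y) - int (dim (Y \<inter> ground M)) - int (dim (Y \<inter> ground N))
      \<le> rank (q_direct_sum scale M N) A"
proof -
  let ?F = "ground M" and ?G = "ground N"
  note m = q_matroidD[OF M] and n = q_matroidD[OF N]
  note fE = finite_dim_sum[OF m(1) n(1)]
  obtain X where X: "X \<in> subspaces scale A" "rank (q_direct_sum scale M N) A
      = rank M ((X + ?G) \<inter> ?F) + rank N ((X + ?F) \<inter> ?G) + int (dim A) - int (dim X)"
    using rank_q_direct_sum_attained[OF M N A] by blast
  have XE: "X \<in> subspaces scale (?F + ?G)"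
    using X(1) A by (auto simp: subspaces_def)
  note d = direct_sum_projections[OF m(1) n(1) XE]
  define P where "P = (X + ?G) \<inter> ?F"
  define Q where "Q = (X + ?F) \<inter> ?G"
  define Y where "Y = A + (P + Q)"
  have P: "P \<in> subspaces scale ?F" and Q: "Q \<in> subspaces scale ?G" and XPQ: "X \<subseteq> P + Q"
    using d by (auto simp: P_def Q_def)
  have s: "subspace ?F" "subspace ?G" "subspace A" "subspace P" "subspace Q" "A \<subseteq> ?F + ?G"
    using m(2) n(2) A P Q by (auto simp: subspaces_def)
  note sPQ = subspace_set_plus[OF s(4,5)] and sE = subspace_set_plus[OF s(1,2)]
  have sY: "subspace Y"
    unfolding Y_def by (rule subspace_set_plus[OF s(3) sPQ])
  have PQE: "P + Q \<subseteq> ?F + ?G"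
    using P Q by (intro set_plus_mono2) (auto simp: subspaces_def)
  have Y: "Y \<in> subspaces scale (?F + ?G)"
    using sY sum_least[OF sE s(6) PQE] by (auto simp: subspaces_def Y_def)
  have AY: "A \<subseteq> Y" and PQY: "P \<subseteq> Y" "Q \<subseteq> Y"
    using sum_upper[OF s(3) sPQ] sum_upper[OF s(4,5)] by (auto simp: Y_def)
  have YF: "Y \<inter> ?F \<in> subspaces scale ?F" and YG: "Y \<inter> ?G \<in> subspaces scale ?G"
    using s sY by (auto simp: subspaces_def intro: subspace_inter)
  have 1: "rank M (Y \<inter> ?F) - rank M P \<le> int (dim (Y \<inter> ?F)) - int (dim P)"
    using rank_diff_le_dim_diff[OF M P YF] P PQY by (auto simp: subspaces_def)
  have 2: "rank N (Y \<inter> ?G) - rank N Q \<le> int (dim (Y \<inter> ?G)) - int (dim Q)"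
    using rank_diff_le_dim_diff[OF N Q YG] Q PQY by (auto simp: subspaces_def)
  have PQ0: "P \<inter> Q = {0}"
    using P Q MN s by (auto simp: subspaces_def dest: subspace_0)
  note fP = finite_dim_subspaces[OF m(1) P] and fQ = finite_dim_subspaces[OF n(1) Q]
  note fPQ = finite_dim_sum[OF fP fQ] and fA = finite_dim_subspaces[OF fE A]
  have "A \<inter> (P + Q) \<in> subspaces scale A" "X \<in> subspaces scale (A \<inter> (P + Q))"
    using X(1) XPQ s sPQ by (auto simp: subspaces_def intro: subspace_inter)
  then have "dim X \<le> dim (A \<inter> (P + Q))"
    using dim_mono_finite finite_dim_subspaces[OF fA] by blast
  then have "int (dim Y) - int (dim P) - int (dim Q) \<le> int (dim A) - int (dim X)"
    using dim_sum_inter[OF fA fPQ] dim_direct_sum[OF fP fQ PQ0] unfolding Y_def by linarith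
  then show thesis
    using that[OF Y AY] 1 2 X(2) unfolding P_def[symmetric] Q_def[symmetric] by linarith
qed

section \<open>Duality of direct sums\<close>

text \<open>
  An anti-isomorphism turns intersections into sums, so \<open>perp (Y \<inter> ground M) = perp Y + G\<close>. The dual
  rank of \<open>Y \<inter> ground M\<close> therefore involves the rank of the projection of \<open>perp Y\<close>.
\<close>

lemma rank_projection_perp:
  assumes M: "q_matroid scale M" and G: "subspace G"
    and P: "involutive_anti_isomorphism scale (ground M + G) perp" and MG: "perp (ground M) = G"
    and Y: "Y \<in> subspaces scale (ground M + G)"
  shows "rank M ((perp Y + G) \<inter> ground M)
    = rank (q_dual scale (\<lambda>A. perp A \<inter> ground M) M) (Y \<inter> ground M)
      - int (dim (Y \<inter> ground M)) + rank M (ground M)"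
proof -
  have s: "subspace (ground M)"
    using q_matroidD(2)[OF M] by (auto simp: subspaces_def)
  have "ground M \<in> subspaces scale (ground M + G)"
    using s sum_upper[OF s G] by (auto simp: subspaces_def)
  then have "perp (Y \<inter> ground M) = perp Y + G"
    using involutive_anti_isomorphismD(5)[OF P Y] MG by auto
  moreover have "Y \<inter> ground M \<in> subspaces scale (ground M)"
    using Y s by (auto simp: subspaces_def intro: subspace_inter)
  ultimately show ?thesis
    by (simp add: q_dual_def)
qed

lemma q_dual_q_direct_sum:
  assumes M: "q_matroid scale M" and N: "q_matroid scale N" and MN: "ground M \<inter> ground N = {0}"
    and P: "involutive_anti_isomorphism scale (ground M + ground N) perp"
    and FG: "perp (ground M) = ground N"
  shows "q_dual scale perp (q_direct_sum scale M N) =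
    q_direct_sum scale (q_dual scale (\<lambda>A. perp A \<inter> ground M) M)
      (q_dual scale (\<lambda>A. perp A \<inter> ground N) N)"
proof -
  let ?F = "ground M" and ?G = "ground N"
  let ?E = "?F + ?G"
  define M' where "M' = q_dual scale (\<lambda>A. perp A \<inter> ?F) M"
  define N' where "N' = q_dual scale (\<lambda>A. perp A \<inter> ?G) N"
  note m = q_matroidD[OF M] and n = q_matroidD[OF N]
  note p = involutive_anti_isomorphismD[OF P]
  note fE = finite_dim_sum[OF m(1) n(1)]
  note dp = dim_perp[OF fE P]
  have g: "ground M' = ?F" "ground N' = ?G"
    by (auto simp: M'_def N'_def q_dual_def)
  have s: "subspace ?F" "subspace ?G"
    using m(2) n(2) by (auto simp: subspaces_def)
  note u = sum_upper[OF s]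
  have F: "?F \<in> subspaces scale ?E"
    using u s by (auto simp: subspaces_def)
  have GF: "perp ?G = ?F"
    using p(2)[OF F] FG by simp
  have MN': "?G \<inter> ?F = {0}" and P': "involutive_anti_isomorphism scale (?G + ?F) perp"
    using MN P by (auto simp: add.commute Int_commute)
  have M': "q_matroid scale M'"
    unfolding M'_def using s MN P FG
    by (intro q_matroid_q_dual M involutive_anti_isomorphism_restrict) unfold_locales
  have N': "q_matroid scale N'"
    unfolding N'_def using s MN' P' GF
    by (intro q_matroid_q_dual N involutive_anti_isomorphism_restrict) unfold_locales
  have M'N': "ground M' \<inter> ground N' = {0}"
    using MN g by simp

  let ?S = "q_direct_sum scale M N" and ?T = "q_direct_sum scale M' N'"
  have gS: "ground ?S = ?E" and gT: "ground ?T = ?E"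
    by (auto simp: g q_direct_sum_def q_union_def add_loops_def)
  \<comment> \<open>The two minimisation problems agree termwise when \<open>Y\<close> is paired with \<open>perp Y\<close>.\<close>
  have termwise: "rank M ((perp Y + ?G) \<inter> ?F) + rank N ((perp Y + ?F) \<inter> ?G)
      + int (dim ?E) - int (dim (perp Y)) - rank ?S ?E
    = rank M' (Y \<inter> ?F) + rank N' (Y \<inter> ?G)
      + int (dim Y) - int (dim (Y \<inter> ?F)) - int (dim (Y \<inter> ?G))"
    if Y: "Y \<in> subspaces scale ?E" for Y
    using rank_projection_perp[OF M s(2) P FG Y] rank_projection_perp[OF N s(1) P' GF] Y
      rank_q_direct_sum_ground[OF M N MN] dp[OF Y]
    by (simp add: M'_def N'_def add.commute)
  have "int (dim A) - rank ?S ?E + rank ?S (perp A) = rank ?T A"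
    if A: "A \<in> subspaces scale ?E" for A
  proof (rule antisym)
    obtain Y where Y: "Y \<in> subspaces scale ?E" "A \<subseteq> Y"
      "rank M' (Y \<inter> ?F) + rank N' (Y \<inter> ?G)
        + int (dim Y) - int (dim (Y \<inter> ?F)) - int (dim (Y \<inter> ?G)) \<le> rank ?T A"
      using rank_q_direct_sum_superspace[OF M' N' M'N'] A unfolding g by metis
    have "perp Y \<in> subspaces scale (perp A)"
      using p(1)[OF Y(1)] p(3)[OF A Y(1,2)] by (auto simp: subspaces_def)
    from rank_q_direct_sum_le[OF M N p(1)[OF A] this]
    show "int (dim A) - rank ?S ?E + rank ?S (perp A) \<le> rank ?T A"
      using Y(3) termwise[OF Y(1)] dp[OF A] by linarith
  next
    obtain X where X: "X \<in> subspaces scale (perp A)" "rank ?S (perp A)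
        = rank M ((X + ?G) \<inter> ?F) + rank N ((X + ?F) \<inter> ?G) + int (dim (perp A)) - int (dim X)"
      using rank_q_direct_sum_attained[OF M N p(1)[OF A]] by blast
    have XE: "X \<in> subspaces scale ?E" and XA: "X \<subseteq> perp A"
      using X(1) p(1)[OF A] by (auto simp: subspaces_def)
    have "A \<subseteq> perp X"
      using p(3)[OF XE p(1)[OF A] XA] p(2)[OF A] by simp
    then show "rank ?T A \<le> int (dim A) - rank ?S ?E + rank ?S (perp A)"
      using rank_q_direct_sum_le_superspace[OF M' N' M'N', of A "perp X"] A p(1)[OF XE]
        termwise[OF p(1)[OF XE]] p(2)[OF XE] X(2) dp[OF A] unfolding g by simp
  qed
  moreover have "rank ?T \<in> extensional (subspaces scale ?E)"
    by (auto simp: g q_direct_sum_def q_union_def add_loops_def)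
  ultimately have "(\<lambda>A\<in>subspaces scale ?E. int (dim A) - rank ?S ?E + rank ?S (perp A)) = rank ?T"
    by (intro extensionalityI[OF restrict_extensional]) auto
  then have "q_dual scale perp ?S = ?T"
    using gT by (simp add: q_dual_def gS prod_eq_iff)
  then show ?thesis
    by (simp add: M'_def N'_def)
qed

end

theorem theorem50:
  fixes scale :: "'k::field \<Rightarrow> 'v::ab_group_add \<Rightarrow> 'v"
    and M1 M2 :: "'v qmat"
    and E E1 E2 :: "'v set"
    and perp :: "'v set \<Rightarrow> 'v set"
  assumes "vector_space scale"
    and "q_matroid scale M1" and "ground M1 = E1"
    and "q_matroid scale M2" and "ground M2 = E2"
    and "E1 \<inter> E2 = {0}" and "E = E1 + E2"
    and "involutive_anti_isomorphism scale E perp"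
    and "perp E1 = E2"
  shows "q_dual scale perp (q_direct_sum scale M1 M2) =
    q_direct_sum scale
      (q_dual scale (\<lambda>A. perp A \<inter> E1) M1)
      (q_dual scale (\<lambda>A. perp A \<inter> E2) M2)"
  using vector_space.q_dual_q_direct_sum[OF assms(1,2,4)] assms(3,5-9) by simp

end
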